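(* Let $p\in(1,2]$ and $q>1$ with $p\neq q$, and let $b_{p,q}:J_p\to J_q$ be the (greedy) base-change function, where $J_p=[0,\frac{1}{p-1}]$. (i) The function $b_{p,q}$ is right continuous. It is left continuous at $x\in(0,\frac{1}{p-1}]$ if and only if the greedy expansion $b_p(x)$ contains infinitely many $1$ digits. The set of discontinuities of $b_{p,q}$ is countable and dense in $J_p$. (ii) If $q<p$, then $b_{p,q}$ is nowhere monotone, it is not left differentiable anywhere (i.e. at any $x\in(0,\frac{1}{p-1}]$), and it is not right differentiable at $x$ if the greedy expansion $b_p(x)$ contains at most finitely many non-zero digits. (iii) If $q>p$, then $b_{p,q}$ is (strictly) increasing, and hence differentiable almost everywhere.
   Context: For a real base $r>1$ and a sequence $c=(c_i)_{i\ge1}\in\{0,1\}^\infty$ put $\pi_r(c):=\sum_{i=1}^\infty c_i r^{-i}$. The sequence $c$ is an expansion of $x$ in base $r$ if $\pi_r(c)=x$, and $J_r:=\pi_r(\{0,1\}^\infty)$ is the set of numbers having at least one expansion in base $r$. For $r\in(1,2]$ one has $J_r=[0,\frac1{r-1}]$. Greedy expansion: for $p\in(1,2]$ and $x\in J_p$, the sequence $b_p(x)=(b_i)$ is defined recursively: if $b_i$ is defined for all $i<n$, then $b_n=1$ if $\left(\sum_{i=1}^{n-1}b_ip^{-i}\right)+p^{-n}\le x$, and $b_n=0$ otherwise. It is an expansion of $x$ in base $p$. The base-change function is $b_{p,q}:=\pi_q\circ b_p:J_p\to J_q$, i.e. $b_{p,q}(x)=\sum_{i\ge1}b_iq^{-i}$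 with $(b_i)=b_p(x)$. "Nowhere monotone" means not monotone on any non-degenerate subinterval of $J_p$. One-sided differentiability means existence of a finite one-sided derivative. "Almost everywhere" refers to Lebesgue measure. "Increasing" means strictly increasing. *)

theory Defs
  imports "HOL-Analysis.Analysis"
begin

text \<open>
  Digit sequences are indexed from 0: the digit \<open>c n\<close> is the mathematical \<open>c\<^sub>n\<^sub>+\<^sub>1\<close>,
  so it carries the weight \<open>1 / r ^ (n + 1)\<close>.
\<close>

definition digit_seqs :: "(nat \<Rightarrow> nat) set" where
  "digit_seqs = UNIV \<rightarrow> {0, 1}"

definition expansion_value :: "real \<Rightarrow> (nat \<Rightarrow> nat) \<Rightarrow> real" where
  "expansion_value r c = (\<Sum>n. real (c n) / r ^ Suc n)"

definition J :: "real \<Rightarrow> real set" where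
  "J r = expansion_value r ` digit_seqs"

fun greedy :: "real \<Rightarrow> real \<Rightarrow> nat \<Rightarrow> nat" where
  "greedy p x n =
     (if (\<Sum>i<n. real (greedy p x i) / p ^ Suc i) + 1 / p ^ Suc n \<le> x then 1 else 0)"

declare greedy.simps [simp del]

text \<open>
  The function below is total on the reals but only meaningful on \<open>J p\<close>; all limits,
  derivatives and monotonicity properties of it are taken relative to \<open>J p\<close>.
\<close>

definition base_change :: "real \<Rightarrow> real \<Rightarrow> real \<Rightarrow> real" where
  "base_change p q x = expansion_value q (greedy p x)"

definition discontinuities_on :: "real set \<Rightarrow> (real \<Rightarrow> real) \<Rightarrow> real set" where
  "discontinuities_on S f = {x \<in> S. \<not> continuous (at x within S) f}"

definition nowhere_monotone_on :: "real set \<Rightarrow> (real \<Rightarrow> real) \<Rightarrow> bool" where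
  "nowhere_monotone_on S f \<longleftrightarrow>
     (\<forall>I \<subseteq> S. is_interval I \<and> (\<exists>x\<in>I. \<exists>y\<in>I. x < y)
        \<longrightarrow> \<not> mono_on I f \<and> \<not> antimono_on I f)"

text \<open>
  One-sided differentiability of a function on \<open>S\<close>: a finite derivative along the part of \<open>S\<close>
  on that side of \<open>x\<close>. It is vacuously true if \<open>x\<close> is not a limit point of that part.
\<close>

definition left_differentiable_on_at :: "real set \<Rightarrow> (real \<Rightarrow> real) \<Rightarrow> real \<Rightarrow> bool" where
  "left_differentiable_on_at S f x \<longleftrightarrow>
     (\<exists>D. (f has_real_derivative D) (at x within S \<inter> {..<x}))"

definition right_differentiable_on_at :: "real set \<Rightarrow> (real \<Rightarrow> real) \<Rightarrow> real \<Rightarrow> bool" where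
  "right_differentiable_on_at S f x \<longleftrightarrow>
     (\<exists>D. (f has_real_derivative D) (at x within S \<inter> {x<..}))"

lemma greedy_in_digit_seqs: "greedy p x \<in> digit_seqs"
proof -
  have "greedy p x n \<in> {0, 1}" for n
    by (subst greedy.simps) simp
  then show ?thesis
    unfolding digit_seqs_def by blast
qed

lemma base_change_in_J: "base_change p q x \<in> J q"
  unfolding base_change_def J_def using greedy_in_digit_seqs by blast

lemma inverse_power_sums:
  fixes r :: real
  assumes "1 < r"
  shows "(\<lambda>n. 1 / r ^ Suc n) sums (1 / (r - 1))"
proof -
  have "(\<lambda>n. (1 / r) * (1 / r) ^ n) sums ((1 / r) * (1 / (1 - 1 / r)))"
    by (intro sums_mult geometric_sums) (use assms in auto)
  moreover have "(1 / r) * (1 / (1 - 1 / r)) = 1 / (r - 1)"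
    using assms by (simp add: field_simps)
  ultimately show ?thesis
    by (simp add: power_one_over divide_inverse power_inverse)
qed

lemma expansion_summable:
  assumes "1 < r" "c \<in> digit_seqs"
  shows "summable (\<lambda>n. real (c n) / r ^ Suc n)"
proof (rule summable_comparison_test')
  show "summable (\<lambda>n. 1 / r ^ Suc n)"
    using inverse_power_sums[OF assms(1)] by (simp add: sums_iff)
  fix n :: nat
  have "c n \<in> {0, 1}" using assms(2) by (auto simp: digit_seqs_def)
  then show "norm (real (c n) / r ^ Suc n) \<le> 1 / r ^ Suc n" using assms(1) by auto
qed

lemma greedy_partial_sum_bounds:
  assumes p: "1 < p" "p \<le> 2" and x: "0 \<le> x" "x \<le> 1 / (p - 1)"
  shows "(\<Sum>i<n. real (greedy p x i) / p ^ Suc i) \<le> x \<and>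
         x - (\<Sum>i<n. real (greedy p x i) / p ^ Suc i) \<le> 1 / (p - 1) / p ^ n"
proof (induction n)
  case 0
  then show ?case using x by simp
next
  case (Suc n)
  define s where "s = (\<Sum>i<n. real (greedy p x i) / p ^ Suc i)"
  have g: "greedy p x n = (if s + 1 / p ^ Suc n \<le> x then 1 else 0)"
    unfolding s_def by (rule greedy.simps)
  have s_Suc: "(\<Sum>i<Suc n. real (greedy p x i) / p ^ Suc i) = s + real (greedy p x n) / p ^ Suc n"
    by (simp add: s_def)
  have b: "s \<le> x" "x - s \<le> 1 / (p - 1) / p ^ n"
    using Suc unfolding s_def by auto
  have "1 / (p - 1) / p ^ n - 1 / p ^ Suc n = 1 / (p - 1) / p ^ Suc n"
    using p by (simp add: field_simps)
  moreover have "1 / p ^ Suc n \<le> 1 / (p - 1) / p ^ Suc n"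
    using p by (intro divide_right_mono) (auto simp: field_simps)
  ultimately show ?case
    unfolding s_Suc using b g by (simp del: power_Suc split: if_splits)
qed

lemma greedy_is_expansion:
  assumes p: "1 < p" "p \<le> 2" and x: "0 \<le> x" "x \<le> 1 / (p - 1)"
  shows "expansion_value p (greedy p x) = x"
proof -
  let ?s = "\<lambda>n. \<Sum>i<n. real (greedy p x i) / p ^ Suc i"
  have "(\<lambda>n. 1 / (p - 1) * (1 / p) ^ n) \<longlonglongrightarrow> 1 / (p - 1) * 0"
    using p by (intro tendsto_intros LIMSEQ_power_zero) auto
  then have lim: "(\<lambda>n. x - 1 / (p - 1) / p ^ n) \<longlonglongrightarrow> x - 0"
    by (intro tendsto_diff tendsto_const) (simp add: power_one_over divide_inverse power_inverse)
  have "?s \<longlonglongrightarrow> x"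
  proof (rule tendsto_sandwich)
    show "(\<lambda>n. x - 1 / (p - 1) / p ^ n) \<longlonglongrightarrow> x" using lim by simp
    show "(\<lambda>n. x) \<longlonglongrightarrow> x" by simp
    show "\<forall>\<^sub>F n in sequentially. x - 1 / (p - 1) / p ^ n \<le> ?s n"
      using greedy_partial_sum_bounds[OF p x] by (intro always_eventually) (smt (verit))
    show "\<forall>\<^sub>F n in sequentially. ?s n \<le> x"
      using greedy_partial_sum_bounds[OF p x] by (intro always_eventually) blast
  qed
  then show ?thesis
    unfolding expansion_value_def by (simp add: sums_def sums_unique[symmetric])
qed

lemma J_eq:
  assumes "1 < p" "p \<le> 2"
  shows "J p = {0..1 / (p - 1)}"
proof
  show "{0..1 / (p - 1)} \<subseteq> J p"
    using greedy_is_expansion[OF assms] greedy_in_digit_seqs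
    unfolding J_def by (metis atLeastAtMost_iff image_eqI subsetI)
  show "J p \<subseteq> {0..1 / (p - 1)}"
  proof
    fix x assume "x \<in> J p"
    then obtain c where c: "c \<in> digit_seqs" and x: "x = expansion_value p c"
      unfolding J_def by auto
    have d: "c n \<in> {0, 1}" for n using c by (auto simp: digit_seqs_def)
    have "0 \<le> x"
      unfolding x expansion_value_def
      using assms by (intro suminf_nonneg expansion_summable c) auto
    moreover have "x \<le> (\<Sum>n. 1 / p ^ Suc n)"
      unfolding x expansion_value_def
    proof (intro suminf_le expansion_summable c assms)
      show "real (c n) / p ^ Suc n \<le> 1 / p ^ Suc n" for n
        using d[of n] assms by auto
      show "summable (\<lambda>n. 1 / p ^ Suc n)"
        using inverse_power_sums[OF assms(1)] by (simp add: sums_iff)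
    qed
    ultimately show "x \<in> {0..1 / (p - 1)}"
      using inverse_power_sums[OF assms(1)] by (simp add: sums_iff)
  qed
qed

end

theory Submission imports Defs begin

text \<open>
  Split an expansion after \<open>n\<close> digits. Replacing the base \<open>p\<close> by \<open>q\<close> multiplies the tail by at most
  \<open>(p / q) ^ (n + 1)\<close> if \<open>q > p\<close>, and by at least that factor if \<open>q < p\<close>. As \<open>y\<close> tends to \<open>x\<close>, every
  greedy digit of \<open>y\<close> stabilises to that of \<open>x\<close>, except from the left when \<open>x\<close> has a last digit
  \<open>1\<close>; that digit then becomes \<open>0\<close>, is compensated in base \<open>p\<close> by the tail, and by the ratio bound
  is not compensated in base \<open>q\<close>. For \<open>q < p\<close> the same bound makes the difference quotients between
  \<open>x\<close> and its truncations, and to the right of a finite expansion, unbounded.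

  For \<open>q > p\<close> Lebesgue's theorem on monotone functions is not needed: the derivative is \<open>0\<close> almost
  everywhere. If \<open>x\<close> and \<open>y\<close> first differ at the \<open>n\<close>-th digit, a truncation to \<open>n\<close> digits lies
  between them. For \<open>p < q' < r < q\<close> there are only \<open>O(q' ^ n)\<close> such truncations, because base change
  to \<open>q'\<close> separates them by a multiple of \<open>1 / q' ^ n\<close> in a bounded interval. By Borel--Cantelli almost
  every \<open>x\<close> has distance at least \<open>1 / r ^ n\<close> from all of them for large \<open>n\<close>, whereas base change to
  \<open>q\<close> moves \<open>x\<close> and \<open>y\<close> apart by only \<open>O(1 / q ^ n)\<close>.
\<close>

text \<open>Keeps the digit \<open>1\<close> from being rewritten to \<open>Suc 0\<close>, so that
  facts about \<open>greedy p x n = 1\<close> still match.\<close>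

declare One_nat_def [simp del]

subsection \<open>Head and tail of a greedy expansion\<close>

text \<open>The base that produces the digits is kept apart from the base that weighs them:
  \<open>greedy_sum p p x n\<close> is a truncation of \<open>x\<close>, and
  \<open>greedy_sum p q x n\<close> is its image under base change.\<close>

definition greedy_sum :: "real \<Rightarrow> real \<Rightarrow> real \<Rightarrow> nat \<Rightarrow> real" where
  "greedy_sum p q x n = (\<Sum>i<n. real (greedy p x i) / q ^ Suc i)"

definition greedy_tail :: "real \<Rightarrow> real \<Rightarrow> real \<Rightarrow> nat \<Rightarrow> real" where
  "greedy_tail p q x n = (\<Sum>i. real (greedy p x (i + n)) / q ^ Suc (i + n))"

lemma greedy_eq: "greedy p x n = (if greedy_sum p p x n + 1 / p ^ Suc n \<le> x then 1 else 0)"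
  unfolding greedy_sum_def by (rule greedy.simps)

lemma greedy_eq_1_iff: "greedy p x n = 1 \<longleftrightarrow> greedy_sum p p x n + 1 / p ^ Suc n \<le> x"
  and greedy_eq_0_iff: "greedy p x n = 0 \<longleftrightarrow> x < greedy_sum p p x n + 1 / p ^ Suc n"
  by (auto simp: greedy_eq[of p x n])

lemma greedy_le_1: "greedy p x n \<le> 1"
  by (simp add: greedy_eq[of p x n])

lemma greedy_neq_0_iff: "greedy p x n \<noteq> 0 \<longleftrightarrow> greedy p x n = 1"
  using greedy_le_1[of p x n] by auto

lemma greedy_sum_0 [simp]: "greedy_sum p q x 0 = 0"
  by (simp add: greedy_sum_def)

lemma greedy_sum_Suc: "greedy_sum p q x (Suc n) = greedy_sum p q x n + real (greedy p x n) / q ^ Suc n"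
  by (simp add: greedy_sum_def)

lemma greedy_sum_cong:
  "(\<And>i. i < n \<Longrightarrow> greedy p x i = greedy p y i) \<Longrightarrow> greedy_sum p q x n = greedy_sum p q y n"
  by (simp add: greedy_sum_def)

lemma greedy_sum_mono:
  assumes "0 < q" "m \<le> n"
  shows "greedy_sum p q x m \<le> greedy_sum p q x n"
  unfolding greedy_sum_def using assms by (intro sum_mono2) auto

lemma greedy_sum_le:
  assumes "0 \<le> x"
  shows "greedy_sum p p x n \<le> x"
proof (induction n)
  case (Suc n)
  then show ?case
    using greedy_eq_1_iff[of p x n] greedy_neq_0_iff[of p x n]
    by (cases "greedy p x n = 0") (auto simp: greedy_sum_Suc)
qed (use assms in simp)

lemma summable_greedy: "1 < q \<Longrightarrow> summable (\<lambda>n. real (greedy p x n) / q ^ Suc n)"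
  by (intro expansion_summable greedy_in_digit_seqs)

lemma summable_greedy_shift:
  "1 < q \<Longrightarrow> summable (\<lambda>i. real (greedy p x (i + n)) / q ^ Suc (i + n))"
  using summable_greedy[of q p x] summable_iff_shift[of "\<lambda>n. real (greedy p x n) / q ^ Suc n" n]
  by blast

lemma base_change_split:
  "1 < q \<Longrightarrow> base_change p q x = greedy_sum p q x n + greedy_tail p q x n"
  unfolding base_change_def expansion_value_def greedy_sum_def greedy_tail_def
  using suminf_split_initial_segment[OF summable_greedy, of q p x n] by simp

lemma greedy_tail_nonneg: "1 < q \<Longrightarrow> 0 \<le> greedy_tail p q x n"
  unfolding greedy_tail_def by (intro suminf_nonneg summable_greedy_shift) auto

lemma greedy_tail_le:
  assumes "1 < q"
  shows "greedy_tail p q x n \<le> 1 / (q - 1) / q ^ n"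
proof -
  have sums: "(\<lambda>i. 1 / q ^ Suc i / q ^ n) sums (1 / (q - 1) / q ^ n)"
    by (intro sums_divide inverse_power_sums assms)
  have "greedy_tail p q x n \<le> (\<Sum>i. 1 / q ^ Suc i / q ^ n)"
    unfolding greedy_tail_def
  proof (intro suminf_le summable_greedy_shift assms)
    show "summable (\<lambda>i. 1 / q ^ Suc i / q ^ n)"
      using sums by (rule sums_summable)
    show "real (greedy p x (i + n)) / q ^ Suc (i + n) \<le> 1 / q ^ Suc i / q ^ n" for i
      using assms greedy_le_1[of p x "i + n"] by (simp add: power_add divide_right_mono mult.assoc)
  qed
  then show ?thesis
    using sums by (simp add: sums_iff)
qed

text \<open>Termwise: passing from base \<open>q\<close> to \<open>r\<close> scales the weight at
  index \<open>i + n\<close> by \<open>(q / r) ^ Suc (i + n)\<close>, and the first weight of the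
  tail, \<open>i = 0\<close>, is scaled down least.\<close>

lemma greedy_tail_ratio:
  assumes "1 < q" "q \<le> r"
  shows "greedy_tail p r x n \<le> (q / r) ^ Suc n * greedy_tail p q x n"
proof -
  have "greedy_tail p r x n \<le> (\<Sum>i. (q / r) ^ Suc n * (real (greedy p x (i + n)) / q ^ Suc (i + n)))"
    unfolding greedy_tail_def
  proof (intro suminf_le summable_greedy_shift summable_mult)
    fix i
    have "(q / r) ^ Suc (i + n) \<le> (q / r) ^ Suc n"
      using assms by (intro power_decreasing) auto
    then have "(q / r) ^ Suc (i + n) * (real (greedy p x (i + n)) / q ^ Suc (i + n))
        \<le> (q / r) ^ Suc n * (real (greedy p x (i + n)) / q ^ Suc (i + n))"
      using assms by (intro mult_right_mono) auto
    moreover have "(q / r) ^ Suc (i + n) * (real (greedy p x (i + n)) / q ^ Suc (i + n))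
        = real (greedy p x (i + n)) / r ^ Suc (i + n)"
      using assms by (simp add: power_divide field_simps)
    ultimately show "real (greedy p x (i + n)) / r ^ Suc (i + n)
        \<le> (q / r) ^ Suc n * (real (greedy p x (i + n)) / q ^ Suc (i + n))"
      by simp
  qed (use assms in auto)
  also have "\<dots> = (q / r) ^ Suc n * greedy_tail p q x n"
    unfolding greedy_tail_def using assms by (intro suminf_mult summable_greedy_shift)
  finally show ?thesis .
qed

text \<open>The same bound solved for the smaller base. With \<open>r = p\<close> it is the source
  of all unbounded difference quotients for \<open>q < p\<close>.\<close>

lemma greedy_tail_ratio_ge:
  assumes "1 < q" "q < r"
  shows "(r / q) ^ Suc n * greedy_tail p r x n \<le> greedy_tail p q x n"
proof -
  have "(r / q) ^ Suc n * greedy_tail p r x n \<le> (r / q) ^ Suc n * ((q / r) ^ Suc n * greedy_tail p q x n)"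
    using assms by (intro mult_left_mono greedy_tail_ratio) auto
  also have "\<dots> = ((r / q) * (q / r)) ^ Suc n * greedy_tail p q x n"
    by (simp only: power_mult_distrib mult.assoc)
  also have "(r / q) * (q / r) = 1"
    using assms by simp
  finally show ?thesis
    by simp
qed

subsection \<open>Stability of the digits\<close>

lemma base_change_close:
  assumes "1 < q" "\<And>i. i < n \<Longrightarrow> greedy p y i = greedy p x i"
  shows "\<bar>base_change p q y - base_change p q x\<bar> \<le> 1 / (q - 1) / q ^ n"
proof -
  have "greedy_sum p q y n = greedy_sum p q x n"
    by (rule greedy_sum_cong) (rule assms)
  then show ?thesis
    using base_change_split[of q p x n] base_change_split[of q p y n] assms(1)
      greedy_tail_nonneg[of q p x n] greedy_tail_nonneg[of q p y n]
      greedy_tail_le[of q p x n] greedy_tail_le[of q p y n]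
    by linarith
qed

lemma const_divide_power_tendsto_0: "1 < q \<Longrightarrow> (\<lambda>n. c / q ^ n) \<longlonglongrightarrow> (0::real)"
  using tendsto_mult_right_zero[OF LIMSEQ_inverse_realpow_zero, of q c] by (simp add: divide_inverse)

text \<open>A digit \<open>0\<close> is a strict inequality for \<open>x\<close>, hence persists
  under small perturbations. A digit \<open>1\<close> is a non-strict one and may be lost, so the
  filter has to keep \<open>y\<close> above the truncation that ends with this digit. The general
  filter serves both sides.\<close>

lemma eventually_greedy_agree:
  assumes "filterlim (\<lambda>y. y) (nhds x) F"
    and "\<And>i. i < n \<Longrightarrow> greedy p x i = 1 \<Longrightarrow> \<forall>\<^sub>F y in F. greedy_sum p p x (Suc i) \<le> y"
  shows "\<forall>\<^sub>F y in F. \<forall>i<n. greedy p y i = greedy p x i"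
  using assms(2)
proof (induction n)
  case (Suc n)
  have IH: "\<forall>\<^sub>F y in F. \<forall>i<n. greedy p y i = greedy p x i"
    using Suc by simp
  show ?case
  proof (cases "greedy p x n = 1")
    case True
    have "\<forall>\<^sub>F y in F. greedy_sum p p x (Suc n) \<le> y"
      using Suc.prems[of n] True by simp
    with IH show ?thesis
    proof eventually_elim
      case (elim y)
      then have "greedy_sum p p y n = greedy_sum p p x n"
        by (intro greedy_sum_cong) auto
      then have "greedy p y n = 1"
        using elim True by (simp add: greedy_eq_1_iff greedy_sum_Suc)
      then show ?case
        using elim True less_Suc_eq by auto
    qed
  next
    case False
    then have 0: "greedy p x n = 0"
      using greedy_neq_0_iff by blast
    then have "\<forall>\<^sub>F y in F. y < greedy_sum p p x n + 1 / p ^ Suc n"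
      by (intro order_tendstoD(2)[OF assms(1)]) (simp only: greedy_eq_0_iff)
    with IH show ?thesis
    proof eventually_elim
      case (elim y)
      then have "greedy_sum p p y n = greedy_sum p p x n"
        by (intro greedy_sum_cong) auto
      then have "greedy p y n = 0"
        using elim by (simp add: greedy_eq_0_iff)
      then show ?case
        using elim 0 less_Suc_eq by auto
    qed
  qed
qed simp

lemma greedy_sum_Suc_le: "greedy p x n = 1 \<Longrightarrow> greedy_sum p p x (Suc n) \<le> x"
  using greedy_eq_1_iff[of p x n] by (simp add: greedy_sum_Suc)

lemma eventually_greedy_agree_right: "\<forall>\<^sub>F y in at_right x. \<forall>i<n. greedy p y i = greedy p x i"
proof (rule eventually_greedy_agree)
  show "filterlim (\<lambda>y. y) (nhds x) (at_right x)"
    by (rule tendsto_ident_at)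
  fix i assume "greedy p x i = 1"
  then show "\<forall>\<^sub>F y in at_right x. greedy_sum p p x (Suc i) \<le> y"
    using greedy_sum_Suc_le[of p x i] by (auto simp: eventually_at_filter)
qed

text \<open>The digit \<open>1\<close> at \<open>n\<close> puts all truncations to at most
  \<open>n\<close> digits strictly below \<open>x\<close>, so \<open>y\<close> near \<open>x\<close>
  stays above them. Digit \<open>n\<close> itself may change.\<close>

lemma eventually_greedy_agree_left:
  assumes "0 < p" "greedy p x n = 1"
  shows "\<forall>\<^sub>F y in at_left x. \<forall>i<n. greedy p y i = greedy p x i"
proof (rule eventually_greedy_agree)
  show lim: "filterlim (\<lambda>y. y) (nhds x) (at_left x)"
    by (rule tendsto_ident_at)
  fix i assume i: "i < n"
  have "greedy_sum p p x (Suc i) \<le> greedy_sum p p x n"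
    using assms i by (intro greedy_sum_mono) auto
  also have "\<dots> < greedy_sum p p x (Suc n)"
    using assms by (simp add: greedy_sum_Suc)
  also have "\<dots> \<le> x"
    by (rule greedy_sum_Suc_le) (rule assms)
  finally have "\<forall>\<^sub>F y in at_left x. greedy_sum p p x (Suc i) < y"
    by (rule order_tendstoD(1)[OF lim])
  then show "\<forall>\<^sub>F y in at_left x. greedy_sum p p x (Suc i) \<le> y"
    by eventually_elim simp
qed

lemma eventually_greedy_agree_left_infinite:
  assumes "0 < p" "infinite {n. greedy p x n = 1}"
  shows "\<forall>\<^sub>F y in at_left x. \<forall>i<n. greedy p y i = greedy p x i"
proof -
  obtain m where "m \<ge> n" "greedy p x m = 1"
    using assms(2) by (auto simp: infinite_nat_iff_unbounded_le)
  then show ?thesis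
    using eventually_greedy_agree_left[OF assms(1), of x m] by (auto elim: eventually_mono)
qed

lemma base_change_tendsto:
  assumes "1 < q" "\<And>n. \<forall>\<^sub>F y in F. \<forall>i<n. greedy p y i = greedy p x i"
  shows "(base_change p q \<longlongrightarrow> base_change p q x) F"
proof (rule tendstoI)
  fix e :: real assume "0 < e"
  then have "\<forall>\<^sub>F n in sequentially. 1 / (q - 1) / q ^ n < e"
    by (intro order_tendstoD(2)[OF const_divide_power_tendsto_0] assms)
  then obtain n where n: "1 / (q - 1) / q ^ n < e"
    by (auto simp: eventually_sequentially)
  show "\<forall>\<^sub>F y in F. dist (base_change p q y) (base_change p q x) < e"
    using assms(2)[of n]
  proof eventually_elim
    case (elim y)
    then show ?case
      using base_change_close[OF assms(1), of n p y x] n by (simp add: dist_real_def)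
  qed
qed

lemma base_change_tendsto_right:
  "1 < q \<Longrightarrow> (base_change p q \<longlongrightarrow> base_change p q x) (at_right x)"
  by (intro base_change_tendsto eventually_greedy_agree_right)

lemma base_change_tendsto_left:
  "0 < p \<Longrightarrow> 1 < q \<Longrightarrow> infinite {n. greedy p x n = 1} \<Longrightarrow>
    (base_change p q \<longlongrightarrow> base_change p q x) (at_left x)"
  by (intro base_change_tendsto eventually_greedy_agree_left_infinite)

text \<open>Truncations are themselves greedy. Before \<open>n\<close>, a digit \<open>1\<close> of
  \<open>x\<close> still fits because partial sums increase, and a digit \<open>0\<close> stays
  because the truncation is at most \<open>x\<close>. From \<open>n\<close> on the head already
  equals the truncation, so every further \<open>1\<close> would overshoot.\<close>

lemma greedy_truncation:
  assumes "0 < p" "0 \<le> x"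
  shows "greedy p (greedy_sum p p x n) i = (if i < n then greedy p x i else 0)"
proof (induction i rule: less_induct)
  case (less i)
  let ?y = "greedy_sum p p x n"
  have pos: "1 / p ^ Suc i > 0"
    using assms by simp
  show ?case
  proof (cases "i < n")
    case True
    have eq: "greedy_sum p p ?y i = greedy_sum p p x i"
      using less True by (intro greedy_sum_cong) auto
    show ?thesis
    proof (cases "greedy p x i = 1")
      case 1: True
      have "greedy_sum p p x (Suc i) \<le> ?y"
        using assms True by (intro greedy_sum_mono) auto
      then show ?thesis
        using True 1 eq greedy_eq_1_iff[of p ?y i] by (simp add: greedy_sum_Suc)
    next
      case False
      then have 0: "greedy p x i = 0"
        using greedy_neq_0_iff by blast
      then show ?thesis
        using True eq greedy_eq_0_iff[of p ?y i] greedy_eq_0_iff[of p x i] greedy_sum_le[OF assms(2), of p n]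
        by simp
    qed
  next
    case False
    have "greedy_sum p p ?y i = (\<Sum>j<i. if j < n then real (greedy p x j) / p ^ Suc j else 0)"
      unfolding greedy_sum_def[of p p ?y i] using less by (intro sum.cong) auto
    also have "\<dots> = ?y"
      unfolding greedy_sum_def using False by (intro sum.mono_neutral_cong_right) auto
    finally show ?thesis
      using False pos greedy_eq_0_iff[of p ?y i] by simp
  qed
qed

lemma greedy_tail_eq_0:
  "(\<And>i. n \<le> i \<Longrightarrow> greedy p x i = 0) \<Longrightarrow> greedy_tail p q x n = 0"
  by (simp add: greedy_tail_def)

lemma base_change_truncation:
  assumes "0 < p" "0 \<le> x" "1 < q"
  shows "base_change p q (greedy_sum p p x n) = greedy_sum p q x n"
proof -
  have "greedy_tail p q (greedy_sum p p x n) n = 0"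
    by (intro greedy_tail_eq_0) (simp add: greedy_truncation assms)
  moreover have "greedy_sum p q (greedy_sum p p x n) n = greedy_sum p q x n"
    by (intro greedy_sum_cong) (simp add: greedy_truncation assms)
  ultimately show ?thesis
    using base_change_split[OF assms(3), of p "greedy_sum p p x n" n] by simp
qed

section \<open>First differing digit and separation of values\<close>

context
  fixes p :: real
  assumes p: "1 < p" "p \<le> 2"
begin

lemma base_change_self: "x \<in> J p \<Longrightarrow> base_change p p x = x"
  unfolding base_change_def using greedy_is_expansion[OF p] by (simp add: J_eq[OF p])

lemma J_nonneg: "x \<in> J p \<Longrightarrow> 0 \<le> x"
  by (simp add: J_eq[OF p])

lemma greedy_expansion_split: "x \<in> J p \<Longrightarrow> x = greedy_sum p p x n + greedy_tail p p x n"
  using base_change_split[OF p(1), of p x n] base_change_self by simp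

text \<open>The greedy order is lexicographic: with equal heads both digits are decided by the same
  threshold, which only the larger number can reach. The threshold is a truncation of
  \<open>y\<close> lying between \<open>x\<close> and \<open>y\<close>.\<close>

lemma first_difference:
  assumes "x \<in> J p" "y \<in> J p" "x < y"
  obtains m where "\<forall>i<m. greedy p y i = greedy p x i"
    "greedy p x m = 0" "greedy p y m = 1"
    "x < greedy_sum p p y (Suc m)" "greedy_sum p p y (Suc m) \<le> y"
proof -
  have "greedy p x \<noteq> greedy p y"
    using assms base_change_self[of x] base_change_self[of y] unfolding base_change_def by auto
  then have ex: "\<exists>m. greedy p y m \<noteq> greedy p x m"
    by (metis ext)
  define m where "m = (LEAST m. greedy p y m \<noteq> greedy p x m)"
  have m: "greedy p y m \<noteq> greedy p x m"
    unfolding m_def by (rule LeastI_ex[OF ex])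
  have below: "greedy p y i = greedy p x i" if "i < m" for i
    using not_less_Least that unfolding m_def by blast
  have s: "greedy_sum p p y m = greedy_sum p p x m"
    by (intro greedy_sum_cong below)
  have "greedy p x m = 0 \<and> greedy p y m = 1"
  proof (rule ccontr)
    assume "\<not> ?thesis"
    then have "greedy p x m = 1" "greedy p y m = 0"
      using m greedy_neq_0_iff by metis+
    then show False
      using greedy_eq_1_iff[of p x m] greedy_eq_0_iff[of p y m] s assms(3) by simp
  qed
  then have x0: "greedy p x m = 0" and y1: "greedy p y m = 1"
    by auto
  show ?thesis
  proof (rule that[OF _ x0 y1])
    show "\<forall>i<m. greedy p y i = greedy p x i"
      using below by simp
    show "x < greedy_sum p p y (Suc m)"
      using x0 y1 s greedy_eq_0_iff[of p x m] by (simp add: greedy_sum_Suc)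
    show "greedy_sum p p y (Suc m) \<le> y"
      by (rule greedy_sum_Suc_le) (rule y1)
  qed
qed

text \<open>In base \<open>q\<close> the number \<open>y\<close> gains \<open>1 / q ^ Suc m\<close>
  at digit \<open>m\<close>. The tail of \<open>x\<close> after this digit is at most
  \<open>1 / p ^ Suc m\<close> in base \<open>p\<close>; changing the base multiplies it by at most
  \<open>(p / q) ^ Suc (Suc m)\<close>, so it makes up only the fraction \<open>p / q\<close> of
  that gain.\<close>

lemma base_change_separation:
  assumes "p < q" "x \<in> J p" "x < greedy_sum p p x m + 1 / p ^ Suc m" "greedy p y m = 1"
    and agree: "\<And>i. i < m \<Longrightarrow> greedy p y i = greedy p x i"
  shows "(1 - p / q) / q ^ Suc m \<le> base_change p q y - base_change p q x"
proof -
  have q: "1 < q"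
    using assms p by simp
  have x0: "greedy p x m = 0"
    using assms(3) by (simp only: greedy_eq_0_iff)
  have "greedy_sum p q y m = greedy_sum p q x m"
    by (intro greedy_sum_cong agree)
  then have y: "greedy_sum p q x m + 1 / q ^ Suc m \<le> base_change p q y"
    using base_change_split[OF q, of p y "Suc m"] greedy_tail_nonneg[OF q, of p y "Suc m"] assms(4)
    by (simp add: greedy_sum_Suc)
  have "greedy_tail p p x (Suc m) \<le> 1 / p ^ Suc m"
    using greedy_expansion_split[OF assms(2), of "Suc m"] assms(3) x0 by (simp add: greedy_sum_Suc)
  then have "(p / q) ^ Suc (Suc m) * greedy_tail p p x (Suc m) \<le> (p / q) ^ Suc (Suc m) * (1 / p ^ Suc m)"
    using p q by (intro mult_left_mono) auto
  also have "\<dots> = p / q / q ^ Suc m"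
    using p q by (simp add: power_divide field_simps)
  finally have "greedy_tail p q x (Suc m) \<le> p / q / q ^ Suc m"
    using greedy_tail_ratio[OF p(1), of q p x "Suc m"] assms(1) by simp
  then have "base_change p q x \<le> greedy_sum p q x m + p / q / q ^ Suc m"
    using base_change_split[OF q, of p x "Suc m"] x0 by (simp add: greedy_sum_Suc)
  then show ?thesis
    using y by (simp add: diff_divide_distrib)
qed

subsection \<open>Monotonicity and one-sided limits\<close>

lemma base_change_strict_mono:
  assumes "p < q"
  shows "strict_mono_on (J p) (base_change p q)"
proof (rule strict_mono_onI)
  fix x y assume xy: "x \<in> J p" "y \<in> J p" "x < y"
  obtain m where m: "\<forall>i<m. greedy p y i = greedy p x i"
    "greedy p x m = 0" "greedy p y m = 1"
    using first_difference[OF xy] by metis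
  have "0 < (1 - p / q) / q ^ Suc m"
    using assms p by simp
  also have "\<dots> \<le> base_change p q y - base_change p q x"
    using base_change_separation[OF assms xy(1), of m y] m by (simp add: greedy_eq_0_iff)
  finally show "base_change p q x < base_change p q y"
    by simp
qed

lemma at_left_J: "x \<in> {0<..1 / (p - 1)} \<Longrightarrow> at x within J p \<inter> {..<x} = at_left x"
  by (rule at_within_nhd[of x "{0<..}"]) (auto simp: J_eq[OF p])

text \<open>Only an inequality: at the right end point of \<open>J p\<close> the filter on the
  left-hand side is \<open>bot\<close>.\<close>

lemma at_right_J: "at x within J p \<inter> {x<..} \<le> at_right x"
  by (rule at_le) auto

lemma eventually_left_in_J:
  assumes "x \<in> {0<..1 / (p - 1)}"
  shows "\<forall>\<^sub>F y in at_left x. y \<in> J p"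
proof -
  have "\<forall>\<^sub>F y in at x within J p \<inter> {..<x}. y \<in> J p"
    by (simp add: eventually_at_filter)
  then show ?thesis
    by (simp only: at_left_J[OF assms])
qed

text \<open>Since \<open>x\<close> is positive, some digit is \<open>1\<close>. At the last one the
  greedy inequality is an equality, so every \<open>y < x\<close> with the same preceding digits has
  digit \<open>0\<close> there.\<close>

lemma last_one:
  assumes "x \<in> {0<..1 / (p - 1)}" "finite {n. greedy p x n = 1}"
  obtains n where "greedy p x n = 1" "\<And>i. n < i \<Longrightarrow> greedy p x i = 0"
    "x = greedy_sum p p x n + 1 / p ^ Suc n"
proof -
  have xJ: "x \<in> J p"
    using assms(1) by (simp add: J_eq[OF p])
  have "{n. greedy p x n = 1} \<noteq> {}"
  proof
    assume "{n. greedy p x n = 1} = {}"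
    then have "greedy p x i = 0" for i
      using greedy_neq_0_iff[of p x i] by auto
    then have "greedy_tail p p x 0 = 0"
      by (intro greedy_tail_eq_0)
    then show False
      using greedy_expansion_split[OF xJ, of 0] assms(1) by simp
  qed
  then have max: "Max {n. greedy p x n = 1} \<in> {n. greedy p x n = 1}"
    using assms(2) by (rule Max_in[rotated])
  define n where "n = Max {n. greedy p x n = 1}"
  have n: "greedy p x n = 1"
    using max by (simp add: n_def)
  have zero: "greedy p x i = 0" if "n < i" for i
  proof (rule ccontr)
    assume "greedy p x i \<noteq> 0"
    then have "i \<le> n"
      unfolding n_def using assms(2) greedy_neq_0_iff[of p x i] by (intro Max_ge) auto
    then show False
      using that by simp
  qed
  have "greedy_tail p p x (Suc n) = 0"
    using zero by (intro greedy_tail_eq_0) simp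
  then have "x = greedy_sum p p x n + 1 / p ^ Suc n"
    using greedy_expansion_split[OF xJ, of "Suc n"] n by (simp add: greedy_sum_Suc)
  then show ?thesis
    using that n zero by blast
qed

text \<open>To the left of \<open>x\<close> the last digit \<open>1\<close> is lost while the
  earlier digits persist; the separation bound then depends on its position only and is uniform in
  \<open>y\<close>.\<close>

lemma base_change_left_jump_up:
  assumes "p < q" "x \<in> {0<..1 / (p - 1)}" "finite {n. greedy p x n = 1}"
  obtains c where "c > 0" "\<forall>\<^sub>F y in at_left x. base_change p q y \<le> base_change p q x - c"
proof -
  obtain n where n: "greedy p x n = 1" "x = greedy_sum p p x n + 1 / p ^ Suc n"
    using last_one[OF assms(2,3)] by metis
  have less: "\<forall>\<^sub>F y in at_left x. y < x"
    by (simp add: eventually_at_filter)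
  have agree: "\<forall>\<^sub>F y in at_left x. \<forall>i<n. greedy p y i = greedy p x i"
    using n p by (intro eventually_greedy_agree_left) auto
  have "0 < (1 - p / q) / q ^ Suc n"
    using assms p by simp
  moreover have "\<forall>\<^sub>F y in at_left x. base_change p q y \<le> base_change p q x - (1 - p / q) / q ^ Suc n"
    using eventually_left_in_J[OF assms(2)] agree less
  proof eventually_elim
    case (elim y)
    then have "greedy_sum p p y n = greedy_sum p p x n"
      by (intro greedy_sum_cong) auto
    then have "(1 - p / q) / q ^ Suc n \<le> base_change p q x - base_change p q y"
      using elim n by (intro base_change_separation assms) auto
    then show ?case
      by simp
  qed
  ultimately show ?thesis
    by (rule that)
qed

text \<open>As \<open>y\<close> increases to \<open>x\<close>, its tail after the lost digit tends
  to \<open>1 / p ^ Suc n\<close> in base \<open>p\<close>. In base \<open>q\<close> it is then at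
  least nearly \<open>p / q / q ^ Suc n\<close>, which exceeds the lost weight
  \<open>1 / q ^ Suc n\<close>.\<close>

lemma base_change_left_jump_down:
  assumes "1 < q" "q < p" "x \<in> {0<..1 / (p - 1)}" "finite {n. greedy p x n = 1}"
  obtains c where "c > 0" "\<forall>\<^sub>F y in at_left x. base_change p q x + c \<le> base_change p q y"
proof -
  obtain n where n: "greedy p x n = 1" "x = greedy_sum p p x n + 1 / p ^ Suc n"
    and zero: "\<And>i. n < i \<Longrightarrow> greedy p x i = 0"
    using last_one[OF assms(3,4)] by metis
  \<comment> \<open>Half of the excess \<open>p / q / q ^ Suc n - 1 / q ^ Suc n\<close>, so that the
    inequality is strict at \<open>x\<close> and survives for nearby \<open>y\<close>.\<close>
  define c where "c = (p / q - 1) / q ^ Suc n / 2"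
  let ?r = "(p / q) ^ Suc (Suc n)"
  have c: "0 < c"
    using assms by (simp add: c_def)
  have r: "0 < ?r"
    using assms by (intro zero_less_power) simp
  have "greedy_tail p q x (Suc n) = 0"
    using zero by (intro greedy_tail_eq_0) simp
  then have fx: "base_change p q x = greedy_sum p q x n + 1 / q ^ Suc n"
    using base_change_split[OF assms(1), of p x "Suc n"] n(1) by (simp add: greedy_sum_Suc)
  have "1 / q ^ Suc n + c < p / q / q ^ Suc n"
    using assms by (simp add: c_def field_simps)
  also have "p / q / q ^ Suc n = ?r * (1 / p ^ Suc n)"
    using assms p by (simp add: power_divide field_simps)
  also have "1 / p ^ Suc n = x - greedy_sum p p x n"
    using n(2) by linarith
  finally have lt: "1 / q ^ Suc n + c < ?r * (x - greedy_sum p p x n)" .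
  have "((\<lambda>y. ?r * (y - greedy_sum p p x n)) \<longlongrightarrow> ?r * (x - greedy_sum p p x n)) (at_left x)"
    by (intro tendsto_intros)
  then have "\<forall>\<^sub>F y in at_left x. 1 / q ^ Suc n + c < ?r * (y - greedy_sum p p x n)"
    using lt by (rule order_tendstoD(1))
  moreover have "\<forall>\<^sub>F y in at_left x. y < x"
    by (simp add: eventually_at_filter)
  moreover have "\<forall>\<^sub>F y in at_left x. \<forall>i<n. greedy p y i = greedy p x i"
    using n p by (intro eventually_greedy_agree_left) auto
  ultimately have "\<forall>\<^sub>F y in at_left x. base_change p q x + c \<le> base_change p q y"
    using eventually_left_in_J[OF assms(3)]
  proof eventually_elim
    case (elim y)
    have sum_eq: "greedy_sum p r y n = greedy_sum p r x n" for r
      using elim by (intro greedy_sum_cong) auto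
    have y0: "greedy p y n = 0"
      using elim n(2) sum_eq[of p] by (simp add: greedy_eq_0_iff)
    have "y - greedy_sum p p x n = greedy_tail p p y (Suc n)"
      using greedy_expansion_split[of y "Suc n"] elim sum_eq[of p] y0 by (simp add: greedy_sum_Suc)
    moreover have "?r * greedy_tail p p y (Suc n) \<le> greedy_tail p q y (Suc n)"
      by (rule greedy_tail_ratio_ge) (use assms in auto)
    ultimately show ?case
      using elim fx base_change_split[OF assms(1), of p y "Suc n"] sum_eq[of q] y0
      by (simp add: greedy_sum_Suc)
  qed
  then show ?thesis
    using that c by blast
qed

lemma base_change_continuous_right: "1 < q \<Longrightarrow> continuous (at x within J p \<inter> {x<..}) (base_change p q)"
  unfolding continuous_within
  by (rule tendsto_mono[OF at_right_J base_change_tendsto_right])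

lemma base_change_continuous_left_iff:
  assumes "1 < q" "p \<noteq> q" "x \<in> {0<..1 / (p - 1)}"
  shows "continuous (at x within J p \<inter> {..<x}) (base_change p q) \<longleftrightarrow> infinite {n. greedy p x n = 1}"
proof
  assume "infinite {n. greedy p x n = 1}"
  then show "continuous (at x within J p \<inter> {..<x}) (base_change p q)"
    unfolding continuous_within at_left_J[OF assms(3)]
    using p assms by (intro base_change_tendsto_left) auto
next
  assume "continuous (at x within J p \<inter> {..<x}) (base_change p q)"
  then have lim: "(base_change p q \<longlongrightarrow> base_change p q x) (at_left x)"
    unfolding continuous_within at_left_J[OF assms(3)] .
  show "infinite {n. greedy p x n = 1}"
  proof
    assume fin: "finite {n. greedy p x n = 1}"
    show False
    proof (cases "p < q")
      case True
      obtain c where c: "c > 0" "\<forall>\<^sub>F y in at_left x. base_change p q y \<le> base_change p q x - c"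
        using base_change_left_jump_up[OF True assms(3) fin] .
      have "base_change p q x \<le> base_change p q x - c"
        by (rule tendsto_upperbound[OF lim c(2)]) simp
      then show False
        using c(1) by simp
    next
      case False
      then have "q < p"
        using assms(2) by simp
      then obtain c where c: "c > 0" "\<forall>\<^sub>F y in at_left x. base_change p q x + c \<le> base_change p q y"
        using base_change_left_jump_down[OF assms(1) _ assms(3) fin] by metis
      have "base_change p q x + c \<le> base_change p q x"
        by (rule tendsto_lowerbound[OF lim c(2)]) simp
      then show False
        using c(1) by simp
    qed
  qed
qed

section \<open>The set of discontinuities\<close>

lemma base_change_discontinuities_eq:
  assumes "1 < q" "p \<noteq> q"
  shows "discontinuities_on (J p) (base_change p q) = {x \<in> {0<..1 / (p - 1)}. finite {n. greedy p x n = 1}}"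
proof -
  have "continuous (at x within J p) (base_change p q) \<longleftrightarrow> infinite {n. greedy p x n = 1}"
    if x: "x \<in> {0<..1 / (p - 1)}" for x
  proof
    assume "continuous (at x within J p) (base_change p q)"
    then have "continuous (at x within J p \<inter> {..<x}) (base_change p q)"
      by (rule continuous_within_subset) auto
    then show "infinite {n. greedy p x n = 1}"
      using base_change_continuous_left_iff assms x by blast
  next
    assume "infinite {n. greedy p x n = 1}"
    \<comment> \<open>Digit stability holds for all real \<open>y\<close>, so the two-sided limit
      exists even at the right end point and is restricted to \<open>J p\<close> afterwards.\<close>
    then have "(base_change p q \<longlongrightarrow> base_change p q x) (at x)"
      unfolding filterlim_at_split
      using p assms by (auto intro: base_change_tendsto_left base_change_tendsto_right)
    then show "continuous (at x within J p) (base_change p q)"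
      unfolding continuous_within by (rule tendsto_within_subset) auto
  qed
  moreover have "continuous (at 0 within J p) (base_change p q)"
  proof -
    have "J p - {0} = J p \<inter> {0<..} - {0}"
      by (auto simp: J_eq[OF p])
    then have "at 0 within J p = at 0 within J p \<inter> {0<..}"
      by (simp add: at_within_def)
    then show ?thesis
      using base_change_continuous_right[OF assms(1), of 0] by simp
  qed
  moreover have "J p = insert 0 {0<..1 / (p - 1)}"
    using p by (auto simp: J_eq[OF p])
  ultimately show ?thesis
    unfolding discontinuities_on_def by auto
qed

lemma base_change_countable_discontinuities:
  assumes "1 < q" "p \<noteq> q"
  shows "countable (discontinuities_on (J p) (base_change p q))"
proof -
  let ?D = "{x \<in> {0<..1 / (p - 1)}. finite {n. greedy p x n = 1}}"
  let ?f = "\<lambda>x. {n. greedy p x n = 1}"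
  \<comment> \<open>A number in \<open>J p\<close> is determined by the set of positions of its
    digits \<open>1\<close>, and there are only countably many finite sets of positions.\<close>
  have "inj_on ?f (J p)"
  proof (rule inj_onI)
    fix x y assume xy: "x \<in> J p" "y \<in> J p" "?f x = ?f y"
    have "greedy p x n = greedy p y n" for n
      using xy(3) greedy_neq_0_iff[of p x n] greedy_neq_0_iff[of p y n]
      by (metis (mono_tags, lifting) mem_Collect_eq)
    then have "greedy p x = greedy p y"
      by (rule ext)
    then show "x = y"
      using base_change_self[OF xy(1)] base_change_self[OF xy(2)] by (simp add: base_change_def)
  qed
  then have "inj_on ?f ?D"
    by (rule inj_on_subset) (auto simp: J_eq[OF p])
  moreover have "countable (?f ` ?D)"
    by (rule countable_subset[OF _ countable_Collect_finite]) auto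
  ultimately show ?thesis
    unfolding base_change_discontinuities_eq[OF assms] using countable_image_inj_on by blast
qed

lemma truncation_tendsto: "x \<in> J p \<Longrightarrow> greedy_sum p p x \<longlonglongrightarrow> x"
  using summable_LIMSEQ[OF summable_greedy[OF p(1), of p x]] base_change_self[of x]
  by (simp add: greedy_sum_def[abs_def] base_change_def expansion_value_def)

lemma base_change_discontinuities_dense:
  assumes "1 < q" "p \<noteq> q"
  shows "J p \<subseteq> closure (discontinuities_on (J p) (base_change p q))"
proof -
  let ?D = "discontinuities_on (J p) (base_change p q)"
  \<comment> \<open>The truncations of \<open>x\<close> have finitely many ones, are eventually
    positive, hence are discontinuities, and converge to \<open>x\<close>.\<close>
  have pos: "x \<in> closure ?D" if x: "x \<in> {0<..1 / (p - 1)}" for x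
  proof -
    have xJ: "x \<in> J p"
      using x by (simp add: J_eq[OF p])
    note lim = truncation_tendsto[OF xJ]
    have "\<forall>\<^sub>F n in sequentially. 0 < greedy_sum p p x n"
      using order_tendstoD(1)[OF lim] x by simp
    then have "\<forall>\<^sub>F n in sequentially. greedy_sum p p x n \<in> ?D"
    proof eventually_elim
      case (elim n)
      have "finite {i. greedy p (greedy_sum p p x n) i = 1}"
        by (rule finite_subset[of _ "{..<n}"])
          (use p x in \<open>auto simp: greedy_truncation split: if_splits\<close>)
      then show ?case
        using elim x greedy_sum_le[of x p n] by (simp add: base_change_discontinuities_eq[OF assms])
    qed
    then have "\<forall>\<^sub>F n in sequentially. greedy_sum p p x n \<in> closure ?D"
      by (rule eventually_mono) (use closure_subset in blast)
    then show ?thesis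
      by (rule Lim_in_closed_set[OF closed_closure _ _ lim]) simp
  qed
  \<comment> \<open>All truncations of \<open>0\<close> are \<open>0\<close>, a point of continuity,
    so \<open>0\<close> is reached as a limit of positive points instead.\<close>
  have "0 \<in> closure {0<..1 / (p - 1)}"
    using p closure_greaterThanAtMost[of 0 "1 / (p - 1)"] by simp
  also have "\<dots> \<subseteq> closure ?D"
    by (rule closure_minimal) (use pos in auto)
  finally have "0 \<in> closure ?D" .
  moreover have "J p = insert 0 {0<..1 / (p - 1)}"
    using p by (auto simp: J_eq[OF p])
  ultimately show ?thesis
    using pos by auto
qed

subsection \<open>Decreasing the base\<close>

text \<open>Beyond the last nonzero digit of \<open>x\<close>, the differences \<open>y - x\<close>
  and of the images are the tails of \<open>y\<close> in bases \<open>p\<close> and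
  \<open>q\<close>. Their ratio is at least \<open>(p / q) ^ Suc n\<close>, where \<open>n\<close>
  can be as large as desired because ever more digits agree.\<close>

lemma base_change_right_growth:
  assumes "1 < q" "q < p" "x \<in> J p" "finite {n. greedy p x n \<noteq> 0}"
  shows "\<forall>\<^sub>F y in at x within J p \<inter> {x<..}. C * (y - x) \<le> base_change p q y - base_change p q x"
proof -
  obtain m where m: "greedy p x i = 0" if "m \<le> i" for i
    using assms(4) by (metis (mono_tags, lifting) finite_nat_set_iff_bounded linorder_not_less mem_Collect_eq)
  obtain k where k: "C < (p / q) ^ k"
    using real_arch_pow[of "p / q" C] assms by auto
  define n where "n = max m k"
  have "(p / q) ^ k \<le> (p / q) ^ Suc n"
    using assms by (intro power_increasing) (auto simp: n_def)
  then have n: "C \<le> (p / q) ^ Suc n"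
    using k by simp
  have x: "greedy_tail p r x n = 0" for r
    by (intro greedy_tail_eq_0 m) (simp add: n_def)
  have "\<forall>\<^sub>F y in at x within J p \<inter> {x<..}. \<forall>i<n. greedy p y i = greedy p x i"
    by (rule filter_leD[OF at_right_J eventually_greedy_agree_right])
  moreover have "\<forall>\<^sub>F y in at x within J p \<inter> {x<..}. y \<in> J p \<inter> {x<..}"
    by (simp add: eventually_at_filter)
  ultimately show ?thesis
  proof eventually_elim
    case (elim y)
    have eq: "greedy_sum p r y n = greedy_sum p r x n" for r
      using elim by (intro greedy_sum_cong) auto
    have "y - x = greedy_tail p p y n"
      using greedy_expansion_split[of y n] greedy_expansion_split[of x n] elim assms(3) x eq by simp
    moreover have "base_change p q y - base_change p q x = greedy_tail p q y n"
      using base_change_split[OF assms(1), of p _ n] x eq by simp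
    moreover have "C * greedy_tail p p y n \<le> (p / q) ^ Suc n * greedy_tail p p y n"
      using n greedy_tail_nonneg[OF p(1)] by (intro mult_right_mono) auto
    ultimately show ?case
      using greedy_tail_ratio_ge[OF assms(1,2), of n p y] by simp
  qed
qed

text \<open>Shows that a number with a finite expansion is not the right end point, where right
  differentiability would hold vacuously.\<close>

lemma greedy_max_infinite: "infinite {n. greedy p (1 / (p - 1)) n \<noteq> 0}"
proof -
  let ?b = "1 / (p - 1)"
  have b: "?b \<in> J p"
    using p by (simp add: J_eq[OF p])
  have "greedy p ?b n = 1" for n
  proof (induction n rule: less_induct)
    case (less n)
    have "greedy_sum p p ?b n = (\<Sum>i<n. 1 / p ^ Suc i)"
      unfolding greedy_sum_def using less by (intro sum.cong) auto
    moreover have "(\<Sum>i<Suc n. 1 / p ^ Suc i) \<le> (\<Sum>i. 1 / p ^ Suc i)"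
      using inverse_power_sums[OF p(1)] p by (intro sum_le_suminf) (auto simp: sums_iff)
    ultimately show ?case
      using inverse_power_sums[OF p(1)] by (simp add: greedy_eq_1_iff sums_iff)
  qed
  then show ?thesis
    by simp
qed

lemma base_change_not_right_differentiable:
  assumes "1 < q" "q < p" "x \<in> J p" "finite {n. greedy p x n \<noteq> 0}"
  shows "\<not> right_differentiable_on_at (J p) (base_change p q) x"
proof
  let ?F = "at x within J p \<inter> {x<..}"
  assume "right_differentiable_on_at (J p) (base_change p q) x"
  then obtain D where "((\<lambda>y. (base_change p q y - base_change p q x) / (y - x)) \<longlongrightarrow> D) ?F"
    unfolding right_differentiable_on_at_def has_field_derivative_iff by blast
  then have "\<forall>\<^sub>F y in ?F. (base_change p q y - base_change p q x) / (y - x) < D + 1"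
    by (rule order_tendstoD) simp
  moreover have "\<forall>\<^sub>F y in ?F. (D + 1) * (y - x) \<le> base_change p q y - base_change p q x"
    by (rule base_change_right_growth) (rule assms)+
  moreover have "\<forall>\<^sub>F y in ?F. y > x"
    by (simp add: eventually_at_filter)
  \<comment> \<open>The quotient would be both below and at least \<open>D + 1\<close>, which only a
    trivial filter allows.\<close>
  ultimately have "\<forall>\<^sub>F y in ?F. False"
    by eventually_elim (simp add: field_simps)
  then have F: "?F = bot"
    by (simp add: eventually_False)
  have "x \<noteq> 1 / (p - 1)"
    using greedy_max_infinite assms(4) by auto
  then have x: "0 \<le> x" "x < 1 / (p - 1)"
    using assms(3) by (auto simp: J_eq[OF p])
  then have "?F = at_right x"
    by (intro at_within_nhd[of x "{..<1 / (p - 1)}"]) (auto simp: J_eq[OF p])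
  then have "at_right x = bot"
    using F by (rule trans[OF sym])
  then show False
    using trivial_limit_at_right_real[of x] by simp
qed

text \<open>With finitely many ones left continuity already fails. Otherwise the truncations
  approach \<open>x\<close> strictly from the left, and along them the difference quotients are at
  least \<open>(p / q) ^ Suc n\<close>.\<close>

lemma base_change_not_left_differentiable:
  assumes "1 < q" "q < p" "x \<in> {0<..1 / (p - 1)}"
  shows "\<not> left_differentiable_on_at (J p) (base_change p q) x"
proof
  let ?F = "at x within J p \<inter> {..<x}"
  assume "left_differentiable_on_at (J p) (base_change p q) x"
  then obtain D where D: "(base_change p q has_real_derivative D) ?F"
    unfolding left_differentiable_on_at_def by blast
  then have "continuous ?F (base_change p q)"
    by (rule DERIV_continuous)
  then have inf: "infinite {n. greedy p x n = 1}"
    using base_change_continuous_left_iff assms by blast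
  have xJ: "x \<in> J p"
    using assms(3) by (simp add: J_eq[OF p])
  let ?s = "greedy_sum p p x"
  have less: "?s n < x" for n
  proof -
    obtain m where m: "m > n" "greedy p x m = 1"
      using inf by (auto simp: infinite_nat_iff_unbounded)
    have "?s n \<le> ?s m"
      using m p by (intro greedy_sum_mono) auto
    also have "?s m < ?s (Suc m)"
      using m p by (simp add: greedy_sum_Suc)
    also have "\<dots> \<le> x"
      using J_nonneg[OF xJ] by (rule greedy_sum_le)
    finally show ?thesis .
  qed
  have "0 \<le> ?s n" for n
    using greedy_sum_mono[of p 0 n p x] p by simp
  then have "?s n \<in> J p" for n
    using less[of n] assms(3) by (auto simp: J_eq[OF p] intro: order.trans[OF less_imp_le])
  then have "filterlim ?s ?F sequentially"
    unfolding filterlim_at using truncation_tendsto[OF xJ] less by (simp add: less_imp_neq)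
  moreover have "((\<lambda>y. (base_change p q y - base_change p q x) / (y - x)) \<longlongrightarrow> D) ?F"
    using D by (simp only: has_field_derivative_iff)
  ultimately have "(\<lambda>n. (base_change p q (?s n) - base_change p q x) / (?s n - x)) \<longlonglongrightarrow> D"
    using filterlim_compose by blast
  then have "\<forall>\<^sub>F n in sequentially. (base_change p q (?s n) - base_change p q x) / (?s n - x) < D + 1"
    by (rule order_tendstoD) simp
  then obtain N where N: "(base_change p q (?s n) - base_change p q x) / (?s n - x) < D + 1" if "n \<ge> N" for n
    by (auto simp: eventually_sequentially)
  obtain k where k: "D + 1 < (p / q) ^ k"
    using real_arch_pow[of "p / q" "D + 1"] assms by auto
  define n where "n = max N k"
  have "(p / q) ^ k \<le> (p / q) ^ Suc n"
    using assms by (intro power_increasing) (auto simp: n_def)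
  then have n: "D + 1 < (p / q) ^ Suc n"
    using k by simp
  have tail: "x - ?s n = greedy_tail p p x n"
    using greedy_expansion_split[OF xJ, of n] by simp
  \<comment> \<open>A truncation is greedy, so its image is the head of the image of
    \<open>x\<close> and the difference is exactly the tail.\<close>
  have "base_change p q x - base_change p q (?s n) = greedy_tail p q x n"
    using base_change_split[OF assms(1), of p x n] base_change_truncation[of p x q n] p assms by simp
  then have "(p / q) ^ Suc n * (x - ?s n) \<le> base_change p q x - base_change p q (?s n)"
    using greedy_tail_ratio_ge[OF assms(1,2), of n p x] tail by simp
  then have "(p / q) ^ Suc n \<le> (base_change p q x - base_change p q (?s n)) / (x - ?s n)"
    using less[of n] by (subst pos_le_divide_eq) auto
  also have "\<dots> = (base_change p q (?s n) - base_change p q x) / (?s n - x)"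
    by (subst minus_divide_divide[symmetric]) (simp only: minus_diff_eq)
  also have "\<dots> < D + 1"
    by (rule N) (simp add: n_def)
  finally show False
    using n by simp
qed

text \<open>Every interval has a discontinuity in its interior. There the function drops when
  reached from the left, and rises to the right by the growth bound with constant
  \<open>1\<close>.\<close>

lemma base_change_nowhere_monotone:
  assumes "1 < q" "q < p"
  shows "nowhere_monotone_on (J p) (base_change p q)"
  unfolding nowhere_monotone_on_def
proof (intro allI impI, elim conjE bexE)
  fix I a b assume I: "I \<subseteq> J p" "is_interval I" "a \<in> I" "b \<in> I" "a < b"
  have sub: "{a..b} \<subseteq> I"
    using mem_is_interval_1_I[OF I(2-4)] by auto
  let ?D = "discontinuities_on (J p) (base_change p q)"
  have "(a + b) / 2 \<in> {a<..<b}"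
    using I(5) by simp
  moreover have "(a + b) / 2 \<in> closure ?D"
  proof -
    have "(a + b) / 2 \<in> I"
      by (rule subsetD[OF sub]) (use I(5) in simp)
    moreover have "J p \<subseteq> closure ?D"
      using assms by (intro base_change_discontinuities_dense) auto
    ultimately show ?thesis
      using I(1) by blast
  qed
  ultimately have "{a<..<b} \<inter> ?D \<noteq> {}"
    using open_Int_closure_eq_empty[OF open_greaterThanLessThan] by blast
  then obtain x where "x \<in> {a<..<b}" "x \<in> ?D"
    by blast
  moreover have "?D = {x \<in> {0<..1 / (p - 1)}. finite {n. greedy p x n = 1}}"
    using assms by (intro base_change_discontinuities_eq) auto
  ultimately have ab: "a < x" "x < b" and x: "x \<in> {0<..1 / (p - 1)}"
    and fin: "finite {n. greedy p x n = 1}"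
    by auto
  have xI: "x \<in> I"
    using sub ab by auto
  obtain c where c: "c > 0" "\<forall>\<^sub>F y in at_left x. base_change p q x + c \<le> base_change p q y"
    using base_change_left_jump_down[OF assms x fin] .
  have "\<forall>\<^sub>F y in at_left x. y \<in> {a<..<x}"
    using ab(1) by (rule eventually_at_leftI[rotated]) simp
  with c(2) have "\<forall>\<^sub>F y in at_left x. a < y \<and> y < x \<and> base_change p q x + c \<le> base_change p q y"
    by eventually_elim auto
  then obtain y where y: "a < y" "y < x" "base_change p q x + c \<le> base_change p q y"
    using eventually_happens[of _ "at_left x"] by auto
  have "y \<in> I"
    using sub ab y by auto
  then have "\<not> mono_on I (base_change p q)"
    using xI y c(1) monotone_onD[of I "(\<le>)" "(\<le>)" "base_change p q" y x] by linarith
  have "\<forall>\<^sub>F z in at_right x. 1 * (z - x) \<le> base_change p q z - base_change p q x"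
  proof -
    have "at_right x = at x within J p \<inter> {x<..}"
    proof (rule at_within_nhd)
      show "x \<in> {a<..<b}"
        using ab by simp
      have "{a<..<b} \<subseteq> J p"
        using sub I(1) by force
      then show "{x<..} \<inter> {a<..<b} - {x} = J p \<inter> {x<..} \<inter> {a<..<b} - {x}"
        by blast
    qed simp
    moreover have "x \<in> J p" "finite {n. greedy p x n \<noteq> 0}"
      using xI I(1) fin by (auto simp only: greedy_neq_0_iff)
    ultimately show ?thesis
      using base_change_right_growth[OF assms, of x 1] by simp
  qed
  moreover have "\<forall>\<^sub>F z in at_right x. z \<in> {x<..<b}"
    using ab(2) by (rule eventually_at_rightI[rotated]) simp
  ultimately have "\<forall>\<^sub>F z in at_right x. x < z \<and> z < b \<and> base_change p q x < base_change p q z"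
    by eventually_elim auto
  then obtain z where z: "x < z" "z < b" "base_change p q x < base_change p q z"
    using eventually_happens[of _ "at_right x"] by auto
  have "z \<in> I"
    using sub ab z by auto
  then have "\<not> antimono_on I (base_change p q)"
    using xI z monotone_onD[of I "(\<le>)" "(\<ge>)" "base_change p q" x z] by linarith
  with \<open>\<not> mono_on I (base_change p q)\<close>
  show "\<not> mono_on I (base_change p q) \<and> \<not> antimono_on I (base_change p q)"
    by blast
qed

subsection \<open>Increasing the base: the derivative vanishes almost everywhere\<close>

lemma base_change_prefix_separation:
  assumes "p < q" "x \<in> J p" "y \<in> J p" "x < y" "greedy_sum p p x n \<noteq> greedy_sum p p y n"
  shows "(1 - p / q) / q ^ n \<le> base_change p q y - base_change p q x"
proof -
  obtain m where m: "\<forall>i<m. greedy p y i = greedy p x i"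
    "greedy p x m = 0" "greedy p y m = 1"
    using first_difference[OF assms(2-4)] by metis
  have "m < n"
  proof (rule ccontr)
    assume "\<not> m < n"
    then have "greedy_sum p p y n = greedy_sum p p x n"
      using m(1) by (intro greedy_sum_cong) simp
    then show False
      using assms(5) by simp
  qed
  then have "q ^ Suc m \<le> q ^ n"
    using assms p by (intro power_increasing) auto
  then have "(1 - p / q) / q ^ n \<le> (1 - p / q) / q ^ Suc m"
    using assms p by (intro divide_left_mono) auto
  also have "\<dots> \<le> base_change p q y - base_change p q x"
    using base_change_separation[OF assms(1,2), of m y] m by (simp add: greedy_eq_0_iff)
  finally show ?thesis .
qed

text \<open>The images of representatives of distinct truncations are at least \<delta> apart in
  \<open>[0, B]\<close>, so rounding down their multiples of \<delta> is injective. The crude count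
  \<open>2 ^ n\<close> would not be summable against \<open>1 / r ^ n\<close> for \<open>r\<close>
  at most \<open>2\<close>; here \<open>q\<close> may be taken close to \<open>p\<close>.\<close>

lemma truncations_card:
  assumes "p < q"
  defines "E \<equiv> \<lambda>n. (\<lambda>y. greedy_sum p p y n) ` J p"
  shows "finite (E n)" and "real (card (E n)) \<le> (1 / (q - 1) / (1 - p / q) + 1) * q ^ n"
proof -
  define \<delta> where "\<delta> = (1 - p / q) / q ^ n"
  define B where "B = 1 / (q - 1)"
  define rep where "rep = inv_into (J p) (\<lambda>y. greedy_sum p p y n)"
  define g where "g = (\<lambda>e. nat \<lfloor>base_change p q (rep e) / \<delta>\<rfloor>)"
  have q: "1 < q"
    using assms(1) p by simp
  have \<delta>: "\<delta> > 0"
    using assms(1) p by (simp add: \<delta>_def)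
  have rep: "rep e \<in> J p" "greedy_sum p p (rep e) n = e" if "e \<in> E n" for e
    using that unfolding E_def rep_def by (auto intro: inv_into_into f_inv_into_f)
  have range: "0 \<le> base_change p q y" "base_change p q y \<le> B" for y
    using base_change_split[OF q, of p y 0] greedy_tail_nonneg[OF q, of p y 0]
      greedy_tail_le[OF q, of p y 0] by (simp_all add: B_def)
  have neq: "g e \<noteq> g e'" if "e \<in> E n" "e' \<in> E n" "rep e < rep e'" for e e'
  proof -
    have "e \<noteq> e'"
      using that(3) by auto
    then have "\<delta> \<le> base_change p q (rep e') - base_change p q (rep e)"
      unfolding \<delta>_def using rep that by (intro base_change_prefix_separation assms(1)) auto
    then have "(base_change p q (rep e) + \<delta>) / \<delta> \<le> base_change p q (rep e') / \<delta>"
      using \<delta> by (intro divide_right_mono) auto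
    then have "base_change p q (rep e) / \<delta> + 1 \<le> base_change p q (rep e') / \<delta>"
      using \<delta> by (simp add: add_divide_distrib)
    moreover have "0 \<le> base_change p q (rep e) / \<delta>"
      using range \<delta> by simp
    ultimately show ?thesis
      unfolding g_def by linarith
  qed
  have inj: "inj_on g (E n)"
  proof (rule inj_onI, rule ccontr)
    fix e e' assume e: "e \<in> E n" "e' \<in> E n" "g e = g e'" "e \<noteq> e'"
    then have "rep e \<noteq> rep e'"
      using rep by metis
    then show False
      using neq[of e e'] neq[of e' e] e by (metis linorder_neqE)
  qed
  have sub: "g ` E n \<subseteq> {..nat \<lfloor>B / \<delta>\<rfloor>}"
    unfolding g_def using range \<delta> by (auto intro!: nat_mono floor_mono divide_right_mono)
  show "finite (E n)"
    using inj_on_finite[OF inj sub] by simp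
  have "card (E n) \<le> nat \<lfloor>B / \<delta>\<rfloor> + 1"
    using card_inj_on_le[OF inj sub] by simp
  moreover have "0 \<le> B / \<delta>"
    using q \<delta> by (simp add: B_def)
  ultimately have "real (card (E n)) \<le> B / \<delta> + 1"
    by linarith
  also have "\<dots> \<le> B / \<delta> + q ^ n"
    using q by simp
  also have "\<dots> = (B / (1 - p / q) + 1) * q ^ n"
    by (simp add: \<delta>_def algebra_simps)
  finally show "real (card (E n)) \<le> (1 / (q - 1) / (1 - p / q) + 1) * q ^ n"
    by (simp add: B_def)
qed

lemma base_change_derivative_0:
  assumes "p < r" "r < q" "x \<in> J p"
    and far: "\<forall>\<^sub>F n in sequentially. \<forall>y \<in> J p. 1 / r ^ n \<le> \<bar>greedy_sum p p y n - x\<bar>"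
  shows "(base_change p q has_real_derivative 0) (at x within J p)"
proof -
  have q: "1 < q" and r: "1 < r"
    using assms p by auto
  obtain N where N: "1 / r ^ n \<le> \<bar>greedy_sum p p y n - x\<bar>" if "N \<le> n" "y \<in> J p" for n y
    using far by (auto simp: eventually_sequentially)
  \<comment> \<open>A finite expansion would coincide with its own truncations, at distance
    \<open>0\<close>. Infinitely many ones make the digits stabilise from the left too, so the first
    difference moves to infinity as \<open>y\<close> tends to \<open>x\<close>.\<close>
  have inf: "infinite {n. greedy p x n = 1}"
  proof
    assume "finite {n. greedy p x n = 1}"
    then obtain m where m: "i < m" if "greedy p x i = 1" for i
      unfolding finite_nat_set_iff_bounded by blast
    define n where "n = max m N"
    have "greedy_tail p p x n = 0"
    proof (rule greedy_tail_eq_0)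
      fix i assume "n \<le> i"
      then show "greedy p x i = 0"
        using m[of i] greedy_neq_0_iff[of p x i] by (auto simp: n_def)
    qed
    then have "greedy_sum p p x n = x"
      using greedy_expansion_split[OF assms(3), of n] by simp
    then have "1 / r ^ n \<le> 0"
      using N[of n x] assms(3) by (simp add: n_def)
    moreover have "0 < 1 / r ^ n"
      using r by simp
    ultimately show False
      by linarith
  qed
  \<comment> \<open>The bound for \<open>m\<close> common digits is
    \<open>1 / (q - 1) / q ^ m\<close>, while the distance bound uses the truncation to
    \<open>Suc m\<close> digits; the factor \<open>q\<close> absorbs this shift.\<close>
  define C where "C = q / (q - 1)"
  have "((\<lambda>y. (base_change p q y - base_change p q x) / (y - x)) \<longlongrightarrow> 0) (at x within J p)"
  proof (rule tendstoI)
    fix \<epsilon> :: real assume "0 < \<epsilon>"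
    moreover have "(\<lambda>n. C / (q / r) ^ n) \<longlonglongrightarrow> 0"
      by (rule const_divide_power_tendsto_0) (use assms r in simp)
    ultimately have "\<forall>\<^sub>F n in sequentially. C / (q / r) ^ n < \<epsilon>"
      by (intro order_tendstoD(2))
    then obtain M where M: "C / (q / r) ^ n < \<epsilon>" if "M \<le> n" for n
      by (auto simp: eventually_sequentially)
    have "\<forall>\<^sub>F y in at x. \<forall>i<max M N. greedy p y i = greedy p x i"
      unfolding eventually_at_split
      using eventually_greedy_agree_left_infinite[OF _ inf] eventually_greedy_agree_right p by simp
    then have "\<forall>\<^sub>F y in at x within J p. \<forall>i<max M N. greedy p y i = greedy p x i"
      by (rule filter_leD[OF at_le, rotated]) simp
    moreover have "\<forall>\<^sub>F y in at x within J p. y \<in> J p \<and> y \<noteq> x"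
      by (simp add: eventually_at_filter)
    ultimately show "\<forall>\<^sub>F y in at x within J p.
        dist ((base_change p q y - base_change p q x) / (y - x)) 0 < \<epsilon>"
    proof eventually_elim
      case (elim y)
      have y: "y \<in> J p" "y \<noteq> x"
        using elim by auto
      \<comment> \<open>Here \<open>z\<close> is the larger of \<open>x\<close> and
        \<open>y\<close>: its truncation through the first differing digit lies between
        them.\<close>
      have "\<exists>m. (\<forall>i<m. greedy p y i = greedy p x i) \<and> greedy p y m \<noteq> greedy p x m \<and>
          (\<exists>z\<in>J p. \<bar>greedy_sum p p z (Suc m) - x\<bar> \<le> \<bar>y - x\<bar>)"
      proof (cases "x < y")
        case True
        obtain m where m: "\<forall>i<m. greedy p y i = greedy p x i"
          "greedy p x m = 0" "greedy p y m = 1"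
          "x < greedy_sum p p y (Suc m)" "greedy_sum p p y (Suc m) \<le> y"
          using first_difference[OF assms(3) y(1) True] .
        have "\<bar>greedy_sum p p y (Suc m) - x\<bar> \<le> \<bar>y - x\<bar>"
          using m(4,5) by linarith
        moreover have "greedy p y m \<noteq> greedy p x m"
          using m(2,3) by simp
        ultimately show ?thesis
          using m(1) y(1) by blast
      next
        case False
        then have "y < x"
          using y by simp
        obtain m where m: "\<forall>i<m. greedy p x i = greedy p y i"
          "greedy p y m = 0" "greedy p x m = 1"
          "y < greedy_sum p p x (Suc m)" "greedy_sum p p x (Suc m) \<le> x"
          using first_difference[OF y(1) assms(3) \<open>y < x\<close>] .
        have "\<bar>greedy_sum p p x (Suc m) - x\<bar> \<le> \<bar>y - x\<bar>"
          using m(4,5) by linarith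
        moreover have "greedy p y m \<noteq> greedy p x m"
          using m(2,3) by simp
        moreover have "\<forall>i<m. greedy p y i = greedy p x i"
          using m(1) by simp
        ultimately show ?thesis
          using assms(3) by blast
      qed
      then obtain m z where m: "\<forall>i<m. greedy p y i = greedy p x i"
        "greedy p y m \<noteq> greedy p x m"
        and z: "z \<in> J p" "\<bar>greedy_sum p p z (Suc m) - x\<bar> \<le> \<bar>y - x\<bar>"
        by blast
      have "\<not> m < max M N"
        using elim m(2) by blast
      then have mMN: "M \<le> Suc m" "N \<le> Suc m"
        by auto
      have "1 / r ^ Suc m \<le> \<bar>y - x\<bar>"
        using N[OF mMN(2) z(1)] z(2) by simp
      have "\<bar>base_change p q y - base_change p q x\<bar> \<le> 1 / (q - 1) / q ^ m"
        using m(1) by (intro base_change_close q) simp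
      also have "\<dots> = C / (q / r) ^ Suc m * (1 / r ^ Suc m)"
        using q r by (simp add: C_def power_divide)
      also have "\<dots> \<le> C / (q / r) ^ Suc m * \<bar>y - x\<bar>"
        using q r \<open>1 / r ^ Suc m \<le> \<bar>y - x\<bar>\<close> by (intro mult_left_mono) (auto simp: C_def)
      also have "\<dots> < \<epsilon> * \<bar>y - x\<bar>"
        using M[OF mMN(1)] y(2) by (intro mult_strict_right_mono) auto
      finally show ?case
        using y(2) by (simp add: dist_real_def abs_divide pos_divide_less_eq)
    qed
  qed
  then show ?thesis
    by (simp only: has_field_derivative_iff)
qed

text \<open>Borel-Cantelli for the intervals of radius \<open>1 / r ^ n\<close> around the
  truncations. With the auxiliary base \<open>q\<close> strictly between \<open>p\<close> and
  \<open>r\<close>, their total length is at most \<open>2 * C * (q / r) ^ n\<close>, a summable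
  geometric bound.\<close>

lemma AE_far_from_truncations:
  assumes "p < r"
  shows "AE x in lborel. \<forall>\<^sub>F n in sequentially. \<forall>y \<in> J p. 1 / r ^ n \<le> \<bar>greedy_sum p p y n - x\<bar>"
proof -
  obtain q where q: "p < q" "q < r"
    using dense assms by blast
  define C where "C = 1 / (q - 1) / (1 - p / q) + 1"
  define E where "E = (\<lambda>n. (\<lambda>y. greedy_sum p p y n) ` J p)"
  define A where "A = (\<lambda>n. \<Union>e\<in>E n. {e - 1 / r ^ n<..<e + 1 / r ^ n})"
  have E: "finite (E n)" "real (card (E n)) \<le> C * q ^ n" for n
    unfolding E_def C_def by (rule truncations_card[OF q(1)])+
  have "AE x in lborel. \<forall>\<^sub>F n in sequentially. x \<in> space lborel - A n"
  proof (rule borel_cantelli_AE1)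
    have "open (A n)" for n
      unfolding A_def by (intro open_UN) auto
    then show "A n \<in> sets lborel" for n
      by simp
    have "bounded (A n)" for n
      unfolding A_def using E(1) by (intro bounded_UN) auto
    then show "emeasure lborel (A n) < \<infinity>" for n
      by (rule emeasure_bounded_finite)
    show "summable (\<lambda>n. measure lborel (A n))"
    proof (rule summable_comparison_test')
      show "summable (\<lambda>n. 2 * C * (q / r) ^ n)"
        using q p by (intro summable_mult summable_geometric) simp
      fix n :: nat
      have pos: "0 < 1 / r ^ n"
        using q p by simp
      have "measure lborel (A n) \<le> (\<Sum>e\<in>E n. measure lborel {e - 1 / r ^ n<..<e + 1 / r ^ n})"
        unfolding A_def by (rule measure_UNION_le[OF E(1)]) simp
      also have "\<dots> = (\<Sum>e\<in>E n. 2 / r ^ n)"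
        using pos by (intro sum.cong) auto
      also have "\<dots> = real (card (E n)) * (2 / r ^ n)"
        by simp
      also have "\<dots> \<le> C * q ^ n * (2 / r ^ n)"
        using pos by (intro mult_right_mono E) auto
      also have "\<dots> = 2 * C * (q / r) ^ n"
        by (simp add: power_divide)
      finally show "norm (measure lborel (A n)) \<le> 2 * C * (q / r) ^ n"
        by simp
    qed
  qed
  then show ?thesis
  proof eventually_elim
    case (elim x)
    then show ?case
    proof eventually_elim
      case (elim n)
      show ?case
      proof
        fix y assume "y \<in> J p"
        then have "greedy_sum p p y n \<in> E n"
          by (simp add: E_def)
        then have "x \<notin> {greedy_sum p p y n - 1 / r ^ n<..<greedy_sum p p y n + 1 / r ^ n}"
          using elim unfolding A_def by blast
        then show "1 / r ^ n \<le> \<bar>greedy_sum p p y n - x\<bar>"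
          unfolding greaterThanLessThan_iff by linarith
      qed
    qed
  qed
qed

lemma base_change_AE_differentiable:
  assumes "p < q"
  shows "AE x in lebesgue. x \<in> J p \<longrightarrow> (\<exists>D. (base_change p q has_real_derivative D) (at x within J p))"
proof (rule AE_completion)
  \<comment> \<open>The strict gap \<open>p < r\<close> makes the exceptional set null, and
    \<open>r < q\<close> makes the difference quotients of order \<open>(r / q) ^ n\<close>.\<close>
  obtain r where r: "p < r" "r < q"
    using dense assms by blast
  from AE_far_from_truncations[OF r(1)]
  show "AE x in lborel. x \<in> J p \<longrightarrow> (\<exists>D. (base_change p q has_real_derivative D) (at x within J p))"
    by eventually_elim (use base_change_derivative_0[OF r] in blast)
qed

end

theorem theorem1p1:
  fixes p q :: real
  assumes "1 < p" "p \<le> 2" "1 < q" "p \<noteq> q"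
  shows
    "((\<forall>x \<in> J p. continuous (at x within J p \<inter> {x<..}) (base_change p q)) \<and>
      (\<forall>x \<in> {0<..1 / (p - 1)}.
         continuous (at x within J p \<inter> {..<x}) (base_change p q)
           \<longleftrightarrow> infinite {n. greedy p x n = 1}) \<and>
      countable (discontinuities_on (J p) (base_change p q)) \<and>
      J p \<subseteq> closure (discontinuities_on (J p) (base_change p q))) \<and>
     (q < p \<longrightarrow>
        nowhere_monotone_on (J p) (base_change p q) \<and>
        (\<forall>x \<in> {0<..1 / (p - 1)}. \<not> left_differentiable_on_at (J p) (base_change p q) x) \<and>
        (\<forall>x \<in> J p. finite {n. greedy p x n \<noteq> 0}
           \<longrightarrow> \<not> right_differentiable_on_at (J p) (base_change p q) x)) \<and>
     (p < q \<longrightarrow>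
        strict_mono_on (J p) (base_change p q) \<and>
        (AE x in lebesgue. x \<in> J p
           \<longrightarrow> (\<exists>D. (base_change p q has_real_derivative D) (at x within J p))))"
  using assms base_change_continuous_right base_change_continuous_left_iff
    base_change_countable_discontinuities base_change_discontinuities_dense
    base_change_nowhere_monotone base_change_not_left_differentiable base_change_not_right_differentiable
    base_change_strict_mono base_change_AE_differentiable
  by (intro conjI impI ballI) simp_all

end
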